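(* For every integer $n\ge 1$, the sequence of denominators of the fractions in the Farey sequence $F_n$, taken in the order in which the fractions appear in $F_n$, is a palindrome. That is, if $F_n = \left(\frac{a_1}{b_1},\frac{a_2}{b_2},\ldots,\frac{a_m}{b_m}\right)$ with $\frac{a_1}{b_1}<\frac{a_2}{b_2}<\cdots<\frac{a_m}{b_m}$ and every fraction in reduced form, then $b_i = b_{m+1-i}$ for all $1\le i\le m$.
   Context: For an integer $n\ge 1$, the Farey sequence $F_n$ (in the interval $[0,1]$) is the increasing finite sequence of all rational numbers in $[0,1]$ which, written in reduced form $\frac{a}{b}$ (with $a \ge 0$, $b\ge 1$, $\gcd(a,b)=1$), have denominator $b \le n$. It starts at $\frac{0}{1}$ and ends at $\frac{1}{1}$. A sequence is called a palindrome if it reads the same forward and backward. *)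

theory Defs
  imports Complex_Main
begin

text \<open>
  \<^term>\<open>quotient_of r\<close> is the reduced form \<open>(a, b)\<close> of the rational \<open>r\<close>, with \<open>b > 0\<close> and
  \<open>coprime a b\<close>.
\<close>

definition denominator :: "rat \<Rightarrow> int" where
  "denominator r = snd (quotient_of r)"

definition farey_set :: "nat \<Rightarrow> rat set" where
  "farey_set n = {r. 0 \<le> r \<and> r \<le> 1 \<and> denominator r \<le> int n}"

definition farey :: "nat \<Rightarrow> rat list" where
  "farey n = sorted_list_of_set (farey_set n)"

definition palindrome :: "'a list \<Rightarrow> bool" where
  "palindrome xs \<longleftrightarrow> rev xs = xs"

text \<open>
  \<^const>\<open>sorted_list_of_set\<close> is only meaningful on finite sets; the following facts show that
  \<^const>\<open>farey\<close> really is the strictly increasing enumeration of \<^const>\<open>farey_set\<close>.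
\<close>

lemma finite_farey_set: "finite (farey_set n)"
proof (rule finite_subset)
  show "farey_set n \<subseteq> (\<lambda>(a, b). of_int a / of_int b) ` ({0..int n} \<times> {1..int n})"
  proof
    fix r assume r: "r \<in> farey_set n"
    obtain a b where q: "quotient_of r = (a, b)" by fastforce
    have b: "b > 0" and rab: "r = of_int a / of_int b"
      using quotient_of_denom_pos[OF q] quotient_of_div[OF q] by auto
    have bn: "b \<le> int n" and r01: "0 \<le> r" "r \<le> 1"
      using r q by (auto simp: farey_set_def denominator_def)
    have "0 \<le> a" "a \<le> b"
      using r01 b by (auto simp: rab zero_le_divide_iff divide_le_eq_1)
    then show "r \<in> (\<lambda>(a, b). of_int a / of_int b) ` ({0..int n} \<times> {1..int n})"
      using b bn rab by (intro image_eqI[where x = "(a, b)"]) auto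
  qed
qed simp

lemma set_farey: "set (farey n) = farey_set n"
  by (simp add: farey_def finite_farey_set)

lemma strict_sorted_farey: "sorted_wrt (<) (farey n)"
  by (simp add: farey_def)

end

theory Submission
  imports Defs
begin

text \<open>
  The reflection \<open>r \<mapsto> 1 - r\<close> preserves reduced denominators, because \<open>gcd (b - a) b = gcd a b\<close>.
  Hence it is an order-reversing bijection of the Farey set onto itself, so it maps the sorted
  list to its reverse without changing any denominator.
\<close>

lemma denominator_one_minus: "denominator (1 - r) = denominator r"
proof -
  obtain a b where q: "quotient_of r = (a, b)" by fastforce
  have b: "b > 0" and r: "r = of_int a / of_int b" and "coprime a b"
    using quotient_of_denom_pos[OF q] quotient_of_div[OF q] quotient_of_coprime[OF q] by auto
  then have "coprime (b - a) b"
    by (metis coprime_iff_gcd_eq_1 gcd.commute gcd_diff2)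
  moreover have "1 - r = Fract (b - a) b"
    using b by (simp add: r Fract_of_int_quotient diff_divide_distrib)
  \<comment> \<open>A coprime pair with positive second entry is already normalized.\<close>
  ultimately have "quotient_of (1 - r) = (b - a, b)"
    using b by (simp add: quotient_of_Fract normalize_stable)
  then show ?thesis
    using q by (simp add: denominator_def)
qed

lemma image_one_minus_farey_set: "(\<lambda>r. 1 - r) ` farey_set n = farey_set n"
proof -
  have sub: "(\<lambda>r. 1 - r) ` farey_set n \<subseteq> farey_set n"
    by (auto simp: farey_set_def denominator_one_minus)
  \<comment> \<open>Reflection is an involution, so \<open>sub\<close> also yields the preimage
    \<open>1 - r\<close>.\<close>
  moreover have "r \<in> (\<lambda>r. 1 - r) ` farey_set n" if "r \<in> farey_set n" for r
    using sub that by (intro image_eqI[where x = "1 - r"]) auto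
  ultimately show ?thesis by blast
qed

text \<open>A strictly increasing list is determined by its set; reversing the reflected list
  restores the increasing order.\<close>

lemma rev_farey: "rev (farey n) = map (\<lambda>r. 1 - r) (farey n)"
proof -
  have "rev (map (\<lambda>r. 1 - r) (farey n)) = farey n"
  proof (rule strict_sorted_equal)
    show "sorted_wrt (<) (rev (map (\<lambda>r. 1 - r) (farey n)))"
      using strict_sorted_farey[of n] by (simp add: sorted_wrt_rev sorted_wrt_map)
    show "set (rev (map (\<lambda>r. 1 - r) (farey n))) = set (farey n)"
      by (simp add: set_farey image_one_minus_farey_set)
  qed (rule strict_sorted_farey)
  then show ?thesis by (metis rev_rev_ident)
qed

theorem theorem3p5:
  fixes n :: nat
  assumes "n \<ge> 1"
  shows "palindrome (map denominator (farey n)) \<and>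
    (\<forall>i. 1 \<le> i \<and> i \<le> length (farey n) \<longrightarrow>
      denominator (farey n ! (i - 1)) =
      denominator (farey n ! ((length (farey n) + 1 - i) - 1)))"
proof (intro conjI allI impI)
  have pal: "rev (map denominator (farey n)) = map denominator (farey n)"
    by (simp add: rev_map rev_farey o_def denominator_one_minus)
  then show "palindrome (map denominator (farey n))"
    by (simp add: palindrome_def)
  fix i assume i: "1 \<le> i \<and> i \<le> length (farey n)"
  then have "map denominator (farey n) ! (i - 1) = rev (map denominator (farey n)) ! (i - 1)"
    by (simp add: pal)
  \<comment> \<open>With indices from 0, \<open>rev\<close> sends \<open>i - 1\<close> to
    \<open>length - 1 - (i - 1)\<close>; the bounds on \<open>i\<close> keep natural subtraction
    from truncating.\<close>
  also have "\<dots> = map denominator (farey n) ! (length (farey n) - i)"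
    using i by (subst rev_nth) auto
  finally show "denominator (farey n ! (i - 1)) =
      denominator (farey n ! ((length (farey n) + 1 - i) - 1))"
    using i by (auto simp: nth_map)
qed

end
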